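(* Let $N\ge2$ and let $(S_i)_{i=0}^{N-1}$ be a permutative representation of the Cuntz algebra $\mathcal{O}_N$ on a Hilbert space $\mathcal{H}$, with permutative orthonormal basis $\{e_\lambda:\lambda\in\Lambda\}$ and encoding mapping $E:\Lambda\to\mathcal{K}_N$. Let $P$ be the associated projection valued measure. Then the representation is purely atomic and supported on $E(\Lambda)$. Moreover, for $\omega\in E(\Lambda)$, $P(\omega)$ is the projection onto the closed span of the vectors $e_\lambda$, $\lambda\in E^{-1}(\omega)$.
   Context: $\mathbb{Z}_N=\{0,1,\dots,N-1\}$. A representation of the Cuntz algebra $\mathcal{O}_N$ on a Hilbert space $\mathcal{H}$ is a family $(S_i)_{i\in\mathbb{Z}_N}$ of bounded operators on $\mathcal{H}$ with $S_i^*S_j=\delta_{ij}I$ for all $i,j$ and $\sum_{i\in\mathbb{Z}_N}S_iS_i^*=I$. For a finite word $I=i_1\dots i_n$, $S_I:=S_{i_1}\cdots S_{i_n}$. $\mathcal{K}_N=\mathbb{Z}_N^{\mathbb{N}}$ is the space of infinite words with the product topology. The projection valued measure $P$ associated to the representation is the unique projection valued measure on the Borel sets of $\mathcal{K}_N$ with $P(\{\omega:\omega_1=i_1,\dots,\omega_k=i_k\})=S_IS_I^*$ for every finite word $I=i_1\dots i_k$. Write $P(\omega)=P(\{\omega\})$. The representation is purely atomic and supported on $\Omega\subset\mathcal{K}_N$ if $\oplus_{\omega\in\Omega}P(\omega)=I$. The representation is permutative with permutative orthonormal basis $\{e_\lambda:\lambda\in\Lambda\}$ if for all $\lambda\in\Lambda$,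 $j\in\mathbb{Z}_N$, $S_je_\lambda$ is an element of this basis; write $S_je_\lambda=e_{\sigma_j(\lambda)}$. The maps $\sigma_j:\Lambda\to\Lambda$ are injective with disjoint ranges whose union is $\Lambda$; let $\sigma:\Lambda\to\Lambda$ be the map with $\sigma(\sigma_j(\lambda))=\lambda$ for all $j,\lambda$. The encoding mapping is $E(\lambda)=j_0j_1j_2\dots$, where $\sigma^k(\lambda)\in\sigma_{j_k}(\Lambda)$ for all $k\ge0$. *)

theory Defs
  imports "HOL-Analysis.Analysis"
begin

section \<open>Complex Hilbert spaces\<close>

text \<open>
  The inner product is linear in the first argument. The last axiom ties it to the norm, so it
  contains positivity and definiteness.
\<close>

class complex_inner = real_normed_vector +
  fixes scaleC :: "complex \<Rightarrow> 'a \<Rightarrow> 'a"  (infixr "*\<^sub>C" 75)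
    and cinner :: "'a \<Rightarrow> 'a \<Rightarrow> complex"
  assumes scaleC_add_right: "c *\<^sub>C (x + y) = c *\<^sub>C x + c *\<^sub>C y"
    and scaleC_add_left: "(c + d) *\<^sub>C x = c *\<^sub>C x + d *\<^sub>C x"
    and scaleC_scaleC: "c *\<^sub>C d *\<^sub>C x = (c * d) *\<^sub>C x"
    and scaleR_scaleC: "r *\<^sub>R x = complex_of_real r *\<^sub>C x"
    and cinner_commute: "cinner x y = cnj (cinner y x)"
    and cinner_add_left: "cinner (x + y) z = cinner x z + cinner y z"
    and cinner_scaleC_left: "cinner (c *\<^sub>C x) y = c * cinner x y"
    and cinner_self: "cinner x x = complex_of_real ((norm x)\<^sup>2)"

class chilbert_space = complex_inner + complete_space

lemma scaleC_one: "1 *\<^sub>C x = (x :: 'a :: complex_inner)"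
  using scaleR_scaleC[of 1 x] by simp

global_interpretation complex_vector:
  vector_space "scaleC :: complex \<Rightarrow> 'a \<Rightarrow> 'a :: complex_inner"
  by unfold_locales (rule scaleC_add_right scaleC_add_left scaleC_scaleC scaleC_one)+

abbreviation cspan :: "'a::complex_inner set \<Rightarrow> 'a set"
  where "cspan \<equiv> complex_vector.span"

definition bounded_clinear :: "('a::complex_inner \<Rightarrow> 'a) \<Rightarrow> bool" where
  "bounded_clinear T \<longleftrightarrow> bounded_linear T \<and> (\<forall>c x. T (c *\<^sub>C x) = c *\<^sub>C T x)"

text \<open>For bounded operators on a Hilbert space the adjoint exists and is unique (Riesz).\<close>

definition cadjoint :: "('a::chilbert_space \<Rightarrow> 'a) \<Rightarrow> 'a \<Rightarrow> 'a" where
  "cadjoint T = (THE T'. \<forall>x y. cinner (T x) y = cinner x (T' y))"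

definition orth_projection :: "('a::chilbert_space \<Rightarrow> 'a) \<Rightarrow> bool" where
  "orth_projection T \<longleftrightarrow> bounded_clinear T \<and> T \<circ> T = T \<and> cadjoint T = T"

definition orth_projection_onto :: "('a::chilbert_space \<Rightarrow> 'a) \<Rightarrow> 'a set \<Rightarrow> bool" where
  "orth_projection_onto T M \<longleftrightarrow> orth_projection T \<and> range T = M"

definition orthonormal_basis :: "'l set \<Rightarrow> ('l \<Rightarrow> 'a::chilbert_space) \<Rightarrow> bool" where
  "orthonormal_basis \<Lambda> e \<longleftrightarrow>
     (\<forall>l\<in>\<Lambda>. \<forall>m\<in>\<Lambda>. cinner (e l) (e m) = (if l = m then 1 else 0)) \<and>
     closure (cspan (e ` \<Lambda>)) = UNIV"


section \<open>Representations of the Cuntz algebra\<close>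

text \<open>Only the operators \<open>S i\<close> with \<open>i < N\<close> matter, in all definitions below.\<close>

definition cuntz_rep :: "nat \<Rightarrow> (nat \<Rightarrow> 'a::chilbert_space \<Rightarrow> 'a) \<Rightarrow> bool" where
  "cuntz_rep N S \<longleftrightarrow>
     (\<forall>i<N. bounded_clinear (S i)) \<and>
     (\<forall>i<N. \<forall>j<N. cadjoint (S i) \<circ> S j = (if i = j then id else (\<lambda>x. 0))) \<and>
     (\<forall>x. (\<Sum>i<N. S i (cadjoint (S i) x)) = x)"

definition word_op :: "(nat \<Rightarrow> 'a \<Rightarrow> 'a) \<Rightarrow> nat list \<Rightarrow> 'a \<Rightarrow> 'a" where
  "word_op S w = foldr (\<lambda>i T. S i \<circ> T) w id"


section \<open>Infinite words and the associated projection valued measure\<close>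

text \<open>Letters of infinite words are numbered from 0.\<close>

definition word_space :: "nat \<Rightarrow> (nat \<Rightarrow> nat) topology" where
  "word_space N = product_topology (\<lambda>_. discrete_topology {..<N}) UNIV"

definition borel_words :: "nat \<Rightarrow> (nat \<Rightarrow> nat) set set" where
  "borel_words N = sigma_sets (topspace (word_space N)) {U. openin (word_space N) U}"

definition cylinder :: "nat \<Rightarrow> nat list \<Rightarrow> (nat \<Rightarrow> nat) set" where
  "cylinder N w = {\<omega> \<in> topspace (word_space N). \<forall>k<length w. \<omega> k = w ! k}"

text \<open>Countable additivity is with respect to the strong operator topology.\<close>

definition projection_valued_measure ::
    "'b set \<Rightarrow> 'b set set \<Rightarrow> ('b set \<Rightarrow> 'a::chilbert_space \<Rightarrow> 'a) \<Rightarrow> bool" where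
  "projection_valued_measure X \<B> P \<longleftrightarrow>
     (\<forall>A\<in>\<B>. orth_projection (P A)) \<and>
     P {} = (\<lambda>x. 0) \<and> P X = id \<and>
     (\<forall>A\<in>\<B>. \<forall>B\<in>\<B>. P (A \<inter> B) = P A \<circ> P B) \<and>
     (\<forall>A :: nat \<Rightarrow> 'b set. range A \<subseteq> \<B> \<and> disjoint_family A \<longrightarrow>
        (\<forall>x. (\<lambda>n. P (A n) x) sums P (\<Union>n. A n) x))"

text \<open>
  The two conditions determine \<open>P\<close> on \<^term>\<open>borel_words N\<close>; its values on other sets are
  irrelevant.
\<close>

definition associated_pvm ::
    "nat \<Rightarrow> (nat \<Rightarrow> 'a::chilbert_space \<Rightarrow> 'a) \<Rightarrow> ((nat \<Rightarrow> nat) set \<Rightarrow> 'a \<Rightarrow> 'a) \<Rightarrow> bool" where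
  "associated_pvm N S P \<longleftrightarrow>
     projection_valued_measure (topspace (word_space N)) (borel_words N) P \<and>
     (\<forall>w. set w \<subseteq> {..<N} \<longrightarrow> P (cylinder N w) = word_op S w \<circ> cadjoint (word_op S w))"

text \<open>
  \<open>\<Oplus>\<^sub>\<omega>\<^sub>\<in>\<^sub>\<Omega> P(\<omega>) = I\<close>: the projections are mutually orthogonal and sum to the identity in the strong
  operator topology. The sum is unordered, since \<open>\<Omega>\<close> may be uncountable.
\<close>

definition purely_atomic_on ::
    "nat \<Rightarrow> ((nat \<Rightarrow> nat) set \<Rightarrow> 'a::chilbert_space \<Rightarrow> 'a) \<Rightarrow> (nat \<Rightarrow> nat) set \<Rightarrow> bool" where
  "purely_atomic_on N P \<Omega> \<longleftrightarrow>
     \<Omega> \<subseteq> topspace (word_space N) \<and>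
     (\<forall>\<omega>\<in>\<Omega>. \<forall>\<omega>'\<in>\<Omega>. \<omega> \<noteq> \<omega>' \<longrightarrow> P {\<omega>} \<circ> P {\<omega>'} = (\<lambda>x. 0)) \<and>
     (\<forall>x. ((\<lambda>\<omega>. P {\<omega>} x) has_sum x) \<Omega>)"


section \<open>Permutative representations\<close>

definition permutative_rep ::
    "nat \<Rightarrow> (nat \<Rightarrow> 'a::chilbert_space \<Rightarrow> 'a) \<Rightarrow> 'l set \<Rightarrow> ('l \<Rightarrow> 'a) \<Rightarrow> bool" where
  "permutative_rep N S \<Lambda> e \<longleftrightarrow>
     cuntz_rep N S \<and> orthonormal_basis \<Lambda> e \<and> (\<forall>l\<in>\<Lambda>. \<forall>j<N. S j (e l) \<in> e ` \<Lambda>)"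

text \<open>
  The branches \<open>\<sigma>\<^sub>j\<close>, their common left inverse \<open>\<sigma>\<close> and the encoding mapping. For a permutative
  representation and \<open>l \<in> \<Lambda>\<close>, \<open>j < N\<close> all three descriptions pick a unique element.
\<close>

definition branch ::
    "(nat \<Rightarrow> 'a \<Rightarrow> 'a) \<Rightarrow> 'l set \<Rightarrow> ('l \<Rightarrow> 'a) \<Rightarrow> nat \<Rightarrow> 'l \<Rightarrow> 'l" where
  "branch S \<Lambda> e j l = (THE m. m \<in> \<Lambda> \<and> S j (e l) = e m)"

definition shift ::
    "nat \<Rightarrow> (nat \<Rightarrow> 'a \<Rightarrow> 'a) \<Rightarrow> 'l set \<Rightarrow> ('l \<Rightarrow> 'a) \<Rightarrow> 'l \<Rightarrow> 'l" where
  "shift N S \<Lambda> e l = (THE m. m \<in> \<Lambda> \<and> (\<exists>j<N. branch S \<Lambda> e j m = l))"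

definition encoding ::
    "nat \<Rightarrow> (nat \<Rightarrow> 'a \<Rightarrow> 'a) \<Rightarrow> 'l set \<Rightarrow> ('l \<Rightarrow> 'a) \<Rightarrow> 'l \<Rightarrow> nat \<Rightarrow> nat" where
  "encoding N S \<Lambda> e l k = (THE j. j < N \<and> (shift N S \<Lambda> e ^^ k) l \<in> branch S \<Lambda> e j ` \<Lambda>)"

end

theory Submission
  imports Defs
begin

text \<open>
  Every basis vector is an eigenvector of every cylinder projection \<open>S\<^sub>w S\<^sub>w\<^sup>*\<close>. The adjoint of
  \<open>S\<^sub>i\<close> sends \<open>e\<^sub>l\<close> to \<open>e\<^bsub>\<sigma>(l)\<^esub>\<close> if the code \<open>E(l)\<close> starts with \<open>i\<close>, and to \<open>0\<close> otherwise; iterating,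
  \<open>S\<^sub>w S\<^sub>w\<^sup>*\<close> fixes \<open>e\<^sub>l\<close> if \<open>w\<close> is a prefix of \<open>E(l)\<close> and kills it otherwise
  (\<open>word_projection_basis\<close>). A word \<open>\<omega>\<close> is the limit of the cylinders given by its prefixes, so
  countable additivity yields that \<open>P(\<omega>)\<close> fixes \<open>e\<^sub>l\<close> if \<open>E(l) = \<omega>\<close> and kills it otherwise
  (\<open>pvm_singleton_basis\<close>).

  Such an operator is determined by its values on the basis. It maps onto the closed span of the basis
  vectors it fixes (\<open>range_coordinate_projection\<close>), which identifies \<open>P(\<omega>)\<close>. The atoms sum to the
  identity: on \<open>e\<^sub>l\<close> only the atom \<open>E(l)\<close> contributes, and since finite sums of atoms are
  contractions (\<open>norm_coordinate_projection_le\<close>), convergence extends from the span of the basis to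
  its closure (\<open>pvm_atoms_has_sum\<close>).

  The existence of the adjoints comes out of the same structure. A permutative \<open>S\<^sub>i\<close> maps the orthonormal basis
  injectively into itself, and distinct \<open>S\<^sub>i\<close> do so with disjoint images; hence the \<open>S\<^sub>i\<close> are isometries
  with orthogonal ranges (\<open>cinner_S_S\<close>), and together with \<open>\<Sum>\<^sub>i S\<^sub>i S\<^sub>i\<^sup>* = I\<close> this proves the adjoint
  equation (\<open>cinner_S_cadjoint\<close>).
\<close>

section \<open>Inner products, density and adjoints\<close>

lemma cinner_add_right: "cinner x (y + z) = cinner x y + cinner x (z :: 'a::complex_inner)"
  by (metis cinner_commute cinner_add_left complex_cnj_add)

lemma cinner_scaleC_right: "cinner x (c *\<^sub>C y) = cnj c * cinner x (y :: 'a::complex_inner)"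
  by (metis cinner_commute cinner_scaleC_left complex_cnj_mult)

lemma cinner_zero_left [simp]: "cinner 0 (y :: 'a::complex_inner) = 0"
  using cinner_add_left[of 0 0 y] by simp

lemma cinner_zero_right [simp]: "cinner (x :: 'a::complex_inner) 0 = 0"
  using cinner_add_right[of x 0 0] by simp

lemma cinner_diff_right: "cinner x (y - z) = cinner x y - cinner x (z :: 'a::complex_inner)"
  using cinner_add_right[of x "y - z" z] by simp

lemma cinner_sum_right:
  "cinner (x :: 'a::complex_inner) (\<Sum>i\<in>I. f i) = (\<Sum>i\<in>I. cinner x (f i))"
  by (induction I rule: infinite_finite_induct) (auto simp: cinner_add_right)

lemma norm_add_square:
  "(norm (x + y :: 'a::complex_inner))\<^sup>2 = (norm x)\<^sup>2 + (norm y)\<^sup>2 + 2 * Re (cinner x y)"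
proof -
  have "complex_of_real ((norm (x + y))\<^sup>2) = cinner (x + y) (x + y)"
    by (rule cinner_self[symmetric])
  also have "\<dots> = complex_of_real ((norm x)\<^sup>2) + complex_of_real ((norm y)\<^sup>2)
      + (cinner x y + cnj (cinner x y))"
    by (simp add: cinner_add_left cinner_add_right cinner_self[of x] cinner_self[of y] cinner_commute[of y x])
  finally have "Re (complex_of_real ((norm (x + y))\<^sup>2)) = Re (complex_of_real ((norm x)\<^sup>2)
      + complex_of_real ((norm y)\<^sup>2) + (cinner x y + cnj (cinner x y)))"
    by simp
  then show ?thesis by simp
qed

text \<open>Polarization writes both parts of the inner product as polynomials in norms, which are
  continuous.\<close>

lemma continuous_on_cinner_right: "continuous_on UNIV (\<lambda>y. cinner (x :: 'a::complex_inner) y)"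
proof -
  have Re: "Re (cinner z y) = ((norm (z + y))\<^sup>2 - (norm z)\<^sup>2 - (norm y)\<^sup>2) / 2" for z y :: 'a
    by (simp add: norm_add_square)
  have "Im (cinner x y) = - Re (cinner (\<i> *\<^sub>C x) y)" for y
    by (simp add: cinner_scaleC_left)
  then have "cinner x y = Complex (Re (cinner x y)) (- Re (cinner (\<i> *\<^sub>C x) y))" for y
    by (simp add: complex_eq_iff)
  then have "(\<lambda>y. cinner x y) =
      (\<lambda>y. complex_of_real (Re (cinner x y)) - \<i> * complex_of_real (Re (cinner (\<i> *\<^sub>C x) y)))"
    by (simp add: complex_eq_iff fun_eq_iff)
  then show ?thesis
    unfolding Re by (simp only:) (intro continuous_intros; simp)
qed

lemma norm_scaleC: "norm (c *\<^sub>C (x :: 'a::complex_inner)) = cmod c * norm x"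
proof -
  have "complex_of_real ((norm (c *\<^sub>C x))\<^sup>2) = c * cnj c * complex_of_real ((norm x)\<^sup>2)"
    unfolding cinner_self[symmetric] by (simp add: cinner_scaleC_left cinner_scaleC_right)
  also have "\<dots> = complex_of_real ((cmod c * norm x)\<^sup>2)"
    by (simp only: power_mult_distrib of_real_mult complex_norm_square)
  finally have "(norm (c *\<^sub>C x))\<^sup>2 = (cmod c * norm x)\<^sup>2"
    unfolding of_real_eq_iff .
  then show ?thesis by (simp add: power2_eq_iff_nonneg)
qed

lemma bounded_linear_scaleC: "bounded_linear (\<lambda>x :: 'a::complex_inner. c *\<^sub>C x)"
  by (rule bounded_linear_intro[of _ "cmod c"])
    (auto simp: scaleC_add_right scaleR_scaleC scaleC_scaleC mult.commute norm_scaleC)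

lemma bounded_clinear_add: "bounded_clinear T \<Longrightarrow> T (x + y) = T x + T y"
  by (simp add: bounded_clinear_def linear_add bounded_linear.linear)

lemma bounded_clinear_scaleC: "bounded_clinear T \<Longrightarrow> T (c *\<^sub>C x) = c *\<^sub>C T x"
  by (simp add: bounded_clinear_def)

lemma bounded_clinear_zero: "bounded_clinear T \<Longrightarrow> T 0 = 0"
  by (simp add: bounded_clinear_def linear_0 bounded_linear.linear)

lemma bounded_clinear_diff: "bounded_clinear T \<Longrightarrow> T (x - y) = T x - T y"
  by (simp add: bounded_clinear_def linear_diff bounded_linear.linear)

lemma bounded_clinear_continuous_on: "bounded_clinear T \<Longrightarrow> continuous_on A T"
  by (simp add: bounded_clinear_def linear_continuous_on)

lemma bounded_clinear_id: "bounded_clinear (\<lambda>x. x)"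
  by (simp add: bounded_clinear_def)

lemma bounded_clinear_const_zero: "bounded_clinear (\<lambda>x. 0)"
  by (simp add: bounded_clinear_def)

lemma bounded_clinear_minus:
  "bounded_clinear T \<Longrightarrow> bounded_clinear U \<Longrightarrow> bounded_clinear (\<lambda>x. T x - U x)"
  by (simp add: bounded_clinear_def bounded_linear_sub complex_vector.scale_right_diff_distrib)

lemma bounded_clinear_sum:
  "(\<And>i. i \<in> I \<Longrightarrow> bounded_clinear (T i)) \<Longrightarrow> bounded_clinear (\<lambda>x. \<Sum>i\<in>I. T i x)"
  by (simp add: bounded_clinear_def bounded_linear_sum complex_vector.scale_sum_right)

lemma cadjoint_eqI:
  fixes T :: "'a::chilbert_space \<Rightarrow> 'a"
  assumes "\<And>x y. cinner (T x) y = cinner x (T' y)"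
  shows "cadjoint T = T'"
  unfolding cadjoint_def
proof (rule the_equality)
  show "\<forall>x y. cinner (T x) y = cinner x (T' y)" using assms by blast
  fix U assume U: "\<forall>x y. cinner (T x) y = cinner x (U y)"
  show "U = T'"
  proof
    fix y
    have "cinner (U y - T' y) (U y - T' y) = 0"
      using U assms unfolding cinner_diff_right by (metis diff_self)
    then show "U y = T' y" by (simp add: cinner_self)
  qed
qed

text \<open>Properties that cut out a closed subspace need to be checked on an orthonormal basis only.\<close>

lemma orthonormal_basis_dense:
  assumes "orthonormal_basis \<Lambda> e" "complex_vector.subspace V" "closed V" "e ` \<Lambda> \<subseteq> V"
  shows "x \<in> V"
proof -
  have "closure (cspan (e ` \<Lambda>)) \<subseteq> V"
    using assms by (intro closure_minimal complex_vector.span_minimal)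
  then show ?thesis using assms(1) by (auto simp: orthonormal_basis_def)
qed

lemma cinner_eq_on_basis:
  assumes ob: "orthonormal_basis \<Lambda> e"
    and A: "bounded_clinear A" and B: "bounded_clinear B"
    and C: "bounded_clinear C" and D: "bounded_clinear D"
    and eq: "\<And>l m. l \<in> \<Lambda> \<Longrightarrow> m \<in> \<Lambda> \<Longrightarrow> cinner (A (e l)) (B (e m)) = cinner (C (e l)) (D (e m))"
  shows "cinner (A x) (B y) = cinner (C x) (D y)"
proof -
  have ext: "cinner u (F y) = cinner v (G y)"
    if F: "bounded_clinear F" and G: "bounded_clinear G"
      and *: "\<And>m. m \<in> \<Lambda> \<Longrightarrow> cinner u (F (e m)) = cinner v (G (e m))" for F G u v y
  proof -
    have "y \<in> {y. cinner u (F y) = cinner v (G y)}"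
    proof (rule orthonormal_basis_dense[OF ob])
      show "complex_vector.subspace {y. cinner u (F y) = cinner v (G y)}"
        using F G
        by (auto simp: complex_vector.subspace_def bounded_clinear_zero bounded_clinear_add
            bounded_clinear_scaleC cinner_add_right cinner_scaleC_right)
      show "closed {y. cinner u (F y) = cinner v (G y)}"
        by (intro closed_Collect_eq continuous_on_compose2[OF continuous_on_cinner_right]
            bounded_clinear_continuous_on F G) auto
    qed (use * in auto)
    then show ?thesis by simp
  qed
  have "cinner (B y) (A (e l)) = cinner (D y) (C (e l))" if "l \<in> \<Lambda>" for l
    using ext[OF B D eq[OF that], of y] by (metis cinner_commute)
  from ext[OF A C this, of x] show ?thesis by (metis cinner_commute)
qed

text \<open>An operator that fixes or kills each basis vector is a coordinate projection: \<open>T x\<close> is orthogonal to \<open>x - T x\<close>, as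
  one sees on basis vectors, and Pythagoras gives the bound.\<close>

lemma norm_coordinate_projection_le:
  fixes T :: "'a::chilbert_space \<Rightarrow> 'a"
  assumes ob: "orthonormal_basis \<Lambda> e" and T: "bounded_clinear T"
    and coord: "\<And>l. l \<in> \<Lambda> \<Longrightarrow> T (e l) = e l \<or> T (e l) = 0"
  shows "norm (T x) \<le> norm x"
proof -
  have "cinner (T (e l)) (e m - T (e m)) = cinner (0 :: 'a) 0" if "l \<in> \<Lambda>" "m \<in> \<Lambda>" for l m
    using coord[OF that(1)] coord[OF that(2)] that ob
    by (cases "l = m") (auto simp: orthonormal_basis_def)
  from cinner_eq_on_basis[OF ob T bounded_clinear_minus[OF bounded_clinear_id T]
      bounded_clinear_const_zero bounded_clinear_const_zero, OF this]
  have "cinner (T x) (x - T x) = cinner (0 :: 'a) 0" .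
  then have "(norm x)\<^sup>2 = (norm (T x))\<^sup>2 + (norm (x - T x))\<^sup>2"
    using norm_add_square[of "T x" "x - T x"] by simp
  then have "(norm (T x))\<^sup>2 \<le> (norm x)\<^sup>2" by simp
  then show ?thesis by simp
qed

text \<open>By continuity: \<open>T\<close> maps the span of the basis into the span of \<open>e ` M\<close>, and it is the identity on
  the latter.\<close>

lemma range_coordinate_projection:
  fixes T :: "'a::chilbert_space \<Rightarrow> 'a"
  assumes ob: "orthonormal_basis \<Lambda> e" and T: "bounded_clinear T"
    and coord: "\<And>l. l \<in> \<Lambda> \<Longrightarrow> T (e l) = (if l \<in> M then e l else 0)"
    and "M \<subseteq> \<Lambda>"
  shows "range T = closure (cspan (e ` M))"
proof
  let ?V = "cspan (e ` M)"
  show "range T \<subseteq> closure ?V"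
  proof clarify
    fix x
    have "x \<in> closure (cspan (e ` \<Lambda>))" using ob by (simp add: orthonormal_basis_def)
    moreover have "T ` closure (cspan (e ` \<Lambda>)) \<subseteq> closure (T ` cspan (e ` \<Lambda>))"
      using T by (intro image_closure_subset bounded_clinear_continuous_on closure_subset) auto
    moreover have "cspan (e ` \<Lambda>) \<subseteq> {x. T x \<in> ?V}"
    proof (rule complex_vector.span_minimal)
      show "e ` \<Lambda> \<subseteq> {x. T x \<in> ?V}"
        using coord by (auto simp: complex_vector.span_base complex_vector.span_zero)
      show "complex_vector.subspace {x. T x \<in> ?V}"
        using T by (auto simp: complex_vector.subspace_def bounded_clinear_zero bounded_clinear_add
            bounded_clinear_scaleC complex_vector.span_zero complex_vector.span_add
            complex_vector.span_scale)
    qed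
    then have "closure (T ` cspan (e ` \<Lambda>)) \<subseteq> closure ?V" by (intro closure_mono) auto
    ultimately show "T x \<in> closure ?V" by blast
  qed
  have "closure ?V \<subseteq> {x. T x = x}"
  proof (intro closure_minimal complex_vector.span_minimal)
    show "e ` M \<subseteq> {x. T x = x}" using coord \<open>M \<subseteq> \<Lambda>\<close> by auto
    show "complex_vector.subspace {x. T x = x}"
      using T by (auto simp: complex_vector.subspace_def bounded_clinear_zero bounded_clinear_add
          bounded_clinear_scaleC)
    show "closed {x. T x = x}"
      by (intro closed_Collect_eq bounded_clinear_continuous_on T continuous_on_id)
  qed
  then show "closure ?V \<subseteq> range T" by (metis (mono_tags) mem_Collect_eq rangeI subset_eq)
qed


section \<open>Permutative representations\<close>

locale permutative_representation =
  fixes N :: nat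
    and S :: "nat \<Rightarrow> 'a::chilbert_space \<Rightarrow> 'a"
    and \<Lambda> :: "'l set"
    and e :: "'l \<Rightarrow> 'a"
  assumes permutative: "permutative_rep N S \<Lambda> e"
begin

abbreviation "\<sigma>\<^sub>b \<equiv> branch S \<Lambda> e"
abbreviation "\<sigma> \<equiv> shift N S \<Lambda> e"
abbreviation "E \<equiv> encoding N S \<Lambda> e"

lemma basis: "orthonormal_basis \<Lambda> e"
  and S_clinear: "i < N \<Longrightarrow> bounded_clinear (S i)"
  and cuntz_sum: "(\<Sum>i<N. S i (cadjoint (S i) x)) = x"
  and S_basis: "l \<in> \<Lambda> \<Longrightarrow> j < N \<Longrightarrow> S j (e l) \<in> e ` \<Lambda>"
  using permutative by (auto simp: permutative_rep_def cuntz_rep_def)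

lemma cuntz_cadjoint_S:
  assumes "i < N" "j < N"
  shows "cadjoint (S i) (S j x) = (if i = j then x else 0)"
proof -
  have "cadjoint (S i) \<circ> S j = (if i = j then id else (\<lambda>x. 0))"
    using permutative assms by (simp add: permutative_rep_def cuntz_rep_def)
  then show ?thesis by (metis comp_apply id_apply)
qed

lemma cinner_basis: "l \<in> \<Lambda> \<Longrightarrow> m \<in> \<Lambda> \<Longrightarrow> cinner (e l) (e m) = (if l = m then 1 else 0)"
  using basis by (auto simp: orthonormal_basis_def)

lemma basis_nonzero: "l \<in> \<Lambda> \<Longrightarrow> e l \<noteq> 0"
  using cinner_basis[of l l] by auto

lemma basis_inj: "l \<in> \<Lambda> \<Longrightarrow> m \<in> \<Lambda> \<Longrightarrow> e l = e m \<longleftrightarrow> l = m"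
  by (metis cinner_basis zero_neq_one)

text \<open>Apply the adjoint of \<open>S i\<close> to both sides: for \<open>i \<noteq> j\<close> it would give \<open>e l = 0\<close>.\<close>

lemma S_basis_eq_iff:
  assumes "l \<in> \<Lambda>" "m \<in> \<Lambda>" "i < N" "j < N"
  shows "S i (e l) = S j (e m) \<longleftrightarrow> i = j \<and> l = m"
  using cuntz_cadjoint_S[OF assms(3,3), of "e l"] cuntz_cadjoint_S[OF assms(3,4), of "e m"]
    assms basis_nonzero[of l] basis_inj[of l m] by (auto split: if_splits)

lemma cinner_S_S:
  assumes "i < N" "j < N"
  shows "cinner (S i x) (S j y) = (if i = j then cinner x y else 0)"
proof -
  have *: "cinner (S i (e l)) (S j (e m)) = (if i = j \<and> l = m then 1 else 0)"
    if lm: "l \<in> \<Lambda>" "m \<in> \<Lambda>" for l m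
  proof -
    obtain l' m' where "l' \<in> \<Lambda>" "m' \<in> \<Lambda>" "S i (e l) = e l'" "S j (e m) = e m'"
      using S_basis[OF lm(1) assms(1)] S_basis[OF lm(2) assms(2)] by auto
    then show ?thesis
      using S_basis_eq_iff[OF lm assms] basis_inj[of l' m'] cinner_basis by auto
  qed
  show ?thesis
  proof (cases "i = j")
    case True
    have "cinner (S i x) (S j y) = cinner x y"
      by (rule cinner_eq_on_basis[OF basis S_clinear[OF assms(1)] S_clinear[OF assms(2)]
          bounded_clinear_id bounded_clinear_id]) (simp add: *[unfolded True] cinner_basis True)
    with True show ?thesis by simp
  next
    case False
    have "cinner (S i x) (S j y) = cinner (0 :: 'a) 0"
      by (rule cinner_eq_on_basis[OF basis S_clinear[OF assms(1)] S_clinear[OF assms(2)]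
          bounded_clinear_const_zero bounded_clinear_const_zero]) (simp add: * False)
    with False show ?thesis by simp
  qed
qed

text \<open>As \<^const>\<open>cadjoint\<close> is a definite description, existence of the adjoint has to be shown. Here it
  comes from the Cuntz relations: expand \<open>y = \<Sum>j<N. S j (cadjoint (S j) y)\<close> and use that the
  \<open>S j\<close> are isometries with orthogonal ranges.\<close>

lemma cinner_S_cadjoint:
  assumes "i < N"
  shows "cinner (S i x) y = cinner x (cadjoint (S i) y)"
proof -
  have "cinner (S i x) y = (\<Sum>j<N. cinner (S i x) (S j (cadjoint (S j) y)))"
    by (simp add: cuntz_sum flip: cinner_sum_right)
  also have "\<dots> = (\<Sum>j<N. if i = j then cinner x (cadjoint (S j) y) else 0)"
    using assms by (intro sum.cong) (auto simp: cinner_S_S)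
  also have "\<dots> = cinner x (cadjoint (S i) y)"
    using assms by simp
  finally show ?thesis .
qed

lemma word_op_Nil [simp]: "word_op S [] = id"
  and word_op_Cons [simp]: "word_op S (i # w) = S i \<circ> word_op S w"
  by (simp_all add: word_op_def)

lemma cinner_word_op_cadjoint:
  assumes "set w \<subseteq> {..<N}"
  shows "cinner (word_op S w x) y = cinner x (cadjoint (word_op S w) y)"
proof -
  have "\<exists>T'. \<forall>x y. cinner (word_op S w x) y = cinner x (T' y)" using assms
  proof (induction w)
    case Nil
    show ?case by (auto intro: exI[of _ id])
  next
    case (Cons i w)
    then obtain T' where "\<And>x y. cinner (word_op S w x) y = cinner x (T' y)" by auto
    then show ?case
      using Cons.prems by (intro exI[of _ "T' \<circ> cadjoint (S i)"]) (simp add: cinner_S_cadjoint)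
  qed
  then obtain T' where T': "\<And>x y. cinner (word_op S w x) y = cinner x (T' y)" by blast
  then show ?thesis using cadjoint_eqI[OF T'] by simp
qed

lemma cadjoint_word_op_Cons:
  assumes "set (i # w) \<subseteq> {..<N}"
  shows "cadjoint (word_op S (i # w)) = cadjoint (word_op S w) \<circ> cadjoint (S i)"
  using assms by (intro cadjoint_eqI) (simp add: cinner_S_cadjoint cinner_word_op_cadjoint)

lemma branch:
  assumes "l \<in> \<Lambda>" "j < N"
  shows "\<sigma>\<^sub>b j l \<in> \<Lambda>" "S j (e l) = e (\<sigma>\<^sub>b j l)"
proof -
  obtain m where m: "m \<in> \<Lambda>" "S j (e l) = e m" using S_basis[OF assms] by blast
  then have "\<sigma>\<^sub>b j l = m" unfolding branch_def
    by (intro the_equality) (auto simp: basis_inj)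
  with m show "\<sigma>\<^sub>b j l \<in> \<Lambda>" "S j (e l) = e (\<sigma>\<^sub>b j l)" by auto
qed

lemma branch_eq_iff:
  assumes "l \<in> \<Lambda>" "m \<in> \<Lambda>" "i < N" "j < N"
  shows "\<sigma>\<^sub>b i l = \<sigma>\<^sub>b j m \<longleftrightarrow> i = j \<and> l = m"
  using S_basis_eq_iff[OF assms] branch[OF assms(1,3)] branch[OF assms(2,4)] basis_inj by auto

text \<open>A basis vector outside all branches would be orthogonal to every \<open>S i (e m)\<close>, so the
  adjoint of every \<open>S i\<close> would kill it, and the relation \<open>\<Sum>\<^sub>i S\<^sub>i S\<^sub>i\<^sup>* = I\<close> would make it zero.\<close>

lemma branch_exhaust:
  assumes "l \<in> \<Lambda>"
  obtains j m where "j < N" "m \<in> \<Lambda>" "l = \<sigma>\<^sub>b j m"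
proof -
  have "\<exists>j<N. \<exists>m\<in>\<Lambda>. l = \<sigma>\<^sub>b j m"
  proof (rule ccontr)
    assume no: "\<not> ?thesis"
    have "cadjoint (S i) (e l) = 0" if i: "i < N" for i
    proof -
      let ?y = "cadjoint (S i) (e l)"
      have "cinner ?y (e m) = 0" if m: "m \<in> \<Lambda>" for m
      proof -
        have "cinner (e m) ?y = cinner (e (\<sigma>\<^sub>b i m)) (e l)"
          using cinner_S_cadjoint[OF i, of "e m" "e l"] branch(2)[OF m i] by simp
        also have "\<dots> = 0"
          using no m i branch(1)[OF m i] assms cinner_basis by auto
        finally show ?thesis using cinner_commute[of ?y "e m"] by simp
      qed
      then have "?y \<in> {y. cinner ?y y = 0}"
        by (intro orthonormal_basis_dense[OF basis] closed_Collect_eq continuous_on_cinner_right)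
          (auto simp: complex_vector.subspace_def cinner_add_right cinner_scaleC_right)
      then show ?thesis by (simp add: cinner_self)
    qed
    then have "e l = 0"
      using cuntz_sum[of "e l"] S_clinear by (simp add: bounded_clinear_zero)
    then show False using basis_nonzero assms by blast
  qed
  then show ?thesis using that by blast
qed

lemma shift_branch:
  assumes "l \<in> \<Lambda>" "j < N"
  shows "\<sigma> (\<sigma>\<^sub>b j l) = l"
  unfolding shift_def using assms branch_eq_iff by (intro the_equality) auto

lemma encoding_branch_0:
  assumes "l \<in> \<Lambda>" "j < N"
  shows "E (\<sigma>\<^sub>b j l) 0 = j"
  unfolding encoding_def using assms branch_eq_iff by (intro the_equality) auto

lemma encoding_Suc: "E l (Suc k) = E (\<sigma> l) k"
  unfolding encoding_def funpow_Suc_right comp_apply ..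

lemma shift_in: "l \<in> \<Lambda> \<Longrightarrow> \<sigma> l \<in> \<Lambda>"
  by (metis branch_exhaust shift_branch)

lemma encoding_less: "l \<in> \<Lambda> \<Longrightarrow> E l k < N"
proof (induction k arbitrary: l)
  case 0
  then show ?case by (metis branch_exhaust encoding_branch_0)
next
  case (Suc k)
  then show ?case by (simp add: encoding_Suc shift_in)
qed

lemma cadjoint_S_basis:
  assumes "l \<in> \<Lambda>" "i < N"
  shows "cadjoint (S i) (e l) = (if E l 0 = i then e (\<sigma> l) else 0)"
proof -
  obtain j m where "j < N" "m \<in> \<Lambda>" "l = \<sigma>\<^sub>b j m" using branch_exhaust assms by blast
  then show ?thesis
    using cuntz_cadjoint_S[OF assms(2), of j "e m"] branch[of m j] shift_branch encoding_branch_0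
    by auto
qed

lemma S_shift: "l \<in> \<Lambda> \<Longrightarrow> S (E l 0) (e (\<sigma> l)) = e l"
  by (metis branch(2) branch_exhaust encoding_branch_0 shift_branch)

text \<open>The adjoints of the letters of \<open>w\<close> strip letters off the encoding of \<open>l\<close> and annihilate the
  vector at the first mismatch; \<^term>\<open>word_op S w\<close> puts the stripped letters back.\<close>

lemma word_projection_basis:
  assumes "l \<in> \<Lambda>" "set w \<subseteq> {..<N}"
  shows "word_op S w (cadjoint (word_op S w) (e l)) = (if \<forall>k<length w. E l k = w ! k then e l else 0)"
  using assms
proof (induction w arbitrary: l)
  case Nil
  have "cadjoint (id :: 'a \<Rightarrow> 'a) = id" by (rule cadjoint_eqI) simp
  then show ?case by (simp add: id_def)
next
  case (Cons i w)
  have adj: "cadjoint (word_op S (i # w)) = cadjoint (word_op S w) \<circ> cadjoint (S i)"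
    by (rule cadjoint_word_op_Cons) (rule Cons.prems)
  have zero: "cadjoint (word_op S w) 0 = 0"
    using cinner_word_op_cadjoint[of w "cadjoint (word_op S w) 0" 0] Cons.prems
    by (simp add: cinner_self)
  have "word_op S w 0 = 0" using Cons.prems(2)
    by (induction w) (auto simp: bounded_clinear_zero[OF S_clinear])
  have step: "word_op S (i # w) (cadjoint (word_op S (i # w)) (e l)) =
      S i (word_op S w (cadjoint (word_op S w) (cadjoint (S i) (e l))))"
    unfolding adj by simp
  show ?case
    unfolding step using \<open>word_op S w 0 = 0\<close> Cons.IH[OF shift_in, of l] Cons.prems zero S_shift[of l] S_clinear[of i]
    by (auto simp: cadjoint_S_basis All_less_Suc2 encoding_Suc
        bounded_clinear_zero)
qed

end


section \<open>The associated projection valued measure\<close>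

lemma topspace_word_space: "topspace (word_space N) = {\<omega>. \<forall>k. \<omega> k < N}"
  by (auto simp: word_space_def PiE_def Pi_def)

lemma cylinder_in_borel_words: "cylinder N w \<in> borel_words N"
proof -
  have "openin (word_space N) (cylinder N w)"
  proof -
    have "cylinder N w = (\<Pi>\<^sub>E k\<in>UNIV. if k < length w then {..<N} \<inter> {w ! k} else {..<N})"
      by (auto simp: cylinder_def topspace_word_space PiE_def Pi_def split: if_splits)
    moreover have "finite {k. (if k < length w then {..<N} \<inter> {w ! k} else {..<N}) \<noteq> {..<N}}"
      by (rule finite_subset[of _ "{..<length w}"]) auto
    ultimately show ?thesis
      unfolding word_space_def by (auto intro!: product_topology_basis)
  qed
  then show ?thesis unfolding borel_words_def by (intro sigma_sets.Basic) simp
qed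

lemma sigma_algebra_borel_words: "sigma_algebra (topspace (word_space N)) (borel_words N)"
  unfolding borel_words_def
  by (intro sigma_algebra_sigma_sets) (auto dest: openin_subset)

definition prefix_cylinder :: "nat \<Rightarrow> (nat \<Rightarrow> nat) \<Rightarrow> nat \<Rightarrow> (nat \<Rightarrow> nat) set" where
  "prefix_cylinder N \<omega> n = cylinder N (map \<omega> [0..<n])"

lemma mem_prefix_cylinder:
  "\<tau> \<in> prefix_cylinder N \<omega> n \<longleftrightarrow> \<tau> \<in> topspace (word_space N) \<and> (\<forall>k<n. \<tau> k = \<omega> k)"
  by (auto simp: prefix_cylinder_def cylinder_def)

lemma prefix_cylinder_in_borel_words: "prefix_cylinder N \<omega> n \<in> borel_words N"
  by (simp add: prefix_cylinder_def cylinder_in_borel_words)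

lemma singleton_in_borel_words:
  assumes "\<omega> \<in> topspace (word_space N)"
  shows "{\<omega>} \<in> borel_words N"
proof -
  interpret sigma_algebra "topspace (word_space N)" "borel_words N"
    by (rule sigma_algebra_borel_words)
  have "\<tau> = \<omega>" if "\<And>n. \<tau> \<in> prefix_cylinder N \<omega> n" for \<tau>
    using that[of "Suc _"] by (auto simp: mem_prefix_cylinder fun_eq_iff)
  then have "{\<omega>} = (\<Inter>n. prefix_cylinder N \<omega> n)"
    using assms by (auto simp: mem_prefix_cylinder)
  then show ?thesis using prefix_cylinder_in_borel_words by auto
qed

context permutative_representation
begin

text \<open>If \<open>E l \<noteq> \<omega>\<close>, some cylinder around \<open>\<omega>\<close> misses \<open>E l\<close>, and its projection already kills \<open>e l\<close>.
  If \<open>E l = \<omega>\<close>, the complement of \<open>\<omega>\<close> is the disjoint union of the differences of consecutive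
  cylinders around \<open>\<omega>\<close>; each projection kills \<open>e l\<close>, so by countable additivity all of
  \<open>e l\<close> sits at \<open>\<omega>\<close>.\<close>

lemma pvm_singleton_basis:
  assumes P: "associated_pvm N S P" and l: "l \<in> \<Lambda>" and \<omega>: "\<omega> \<in> topspace (word_space N)"
  shows "P {\<omega>} (e l) = (if E l = \<omega> then e l else 0)"
proof -
  let ?K = "topspace (word_space N)"
  let ?C = "prefix_cylinder N \<omega>"
  interpret sigma_algebra ?K "borel_words N"
    by (rule sigma_algebra_borel_words)
  have pvm: "projection_valued_measure ?K (borel_words N) P"
    using P by (simp add: associated_pvm_def)
  have zero: "P A 0 = 0" if "A \<in> borel_words N" for A
    using pvm that bounded_clinear_zero
    by (auto simp: projection_valued_measure_def orth_projection_def)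
  have inter: "P A (P B x) = P (A \<inter> B) x" if "A \<in> borel_words N" "B \<in> borel_words N" for A B x
    using pvm that by (auto simp: projection_valued_measure_def)
  have empty: "P {} = (\<lambda>x. 0)" and total: "P ?K = id"
    using pvm by (auto simp: projection_valued_measure_def)
  have sing: "{\<omega>} \<in> borel_words N" by (rule singleton_in_borel_words[OF \<omega>])
  have cyl: "P (?C n) (e l) = (if \<forall>k<n. E l k = \<omega> k then e l else 0)" for n
  proof -
    have "set (map \<omega> [0..<n]) \<subseteq> {..<N}" using \<omega> by (auto simp: topspace_word_space)
    then show ?thesis
      using P word_projection_basis[OF l] by (simp add: associated_pvm_def prefix_cylinder_def)
  qed
  show ?thesis
  proof (cases "E l = \<omega>")
    case False
    then obtain n where "E l n \<noteq> \<omega> n" by blast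
    then have "P (?C (Suc n)) (e l) = 0" unfolding cyl by auto
    moreover have "{\<omega>} \<inter> ?C (Suc n) = {\<omega>}" using \<omega> by (auto simp: mem_prefix_cylinder)
    ultimately have "P {\<omega>} (e l) = 0"
      using inter[OF sing prefix_cylinder_in_borel_words] zero[OF sing] by metis
    with False show ?thesis by simp
  next
    case True
    \<comment> \<open>The point itself comes first, so that only the term with index \<open>0\<close> of the sum survives.\<close>
    define A where "A = case_nat {\<omega>} (\<lambda>n. ?C n - ?C (Suc n))"
    have A_borel: "range A \<subseteq> borel_words N"
      by (auto simp: A_def sing split: nat.splits intro!: Diff prefix_cylinder_in_borel_words)
    have disj: "disjoint_family A"
    proof -
      have "A i \<inter> A j = {}" if "i < j" for i j
        using that \<omega> by (auto simp: A_def mem_prefix_cylinder split: nat.splits)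
      then show ?thesis
        unfolding disjoint_family_on_def by (metis Int_commute linorder_neqE_nat)
    qed
    have union: "(\<Union>n. A n) = ?K"
    proof
      show "(\<Union>n. A n) \<subseteq> ?K"
        using \<omega> by (auto simp: A_def mem_prefix_cylinder split: nat.splits)
      show "?K \<subseteq> (\<Union>n. A n)"
      proof
        fix \<tau> assume \<tau>: "\<tau> \<in> ?K"
        show "\<tau> \<in> (\<Union>n. A n)"
        proof (cases "\<tau> = \<omega>")
          case True
          then have "\<tau> \<in> A 0" by (simp add: A_def)
          then show ?thesis by blast
        next
          case False
          \<comment> \<open>The first disagreement with \<open>\<omega>\<close> tells which difference contains \<open>\<tau>\<close>.\<close>
          define n where "n = (LEAST n. \<tau> n \<noteq> \<omega> n)"
          obtain m where "\<tau> m \<noteq> \<omega> m" using False by blast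
          then have "\<tau> n \<noteq> \<omega> n" unfolding n_def by (rule LeastI)
          moreover have "\<tau> k = \<omega> k" if "k < n" for k
            using not_less_Least[OF that[unfolded n_def]] by simp
          ultimately have "\<tau> \<in> A (Suc n)" using \<tau> by (auto simp: A_def mem_prefix_cylinder)
          then show ?thesis by blast
        qed
      qed
    qed
    have "(\<lambda>n. P (A n) (e l)) sums e l"
      using pvm A_borel disj union total unfolding projection_valued_measure_def
      by (metis id_apply)
    moreover have "P (A n) (e l) = 0" if "n \<noteq> 0" for n
    proof -
      obtain m where n: "n = Suc m" using \<open>n \<noteq> 0\<close> by (cases n) auto
      have "P (?C (Suc m)) (e l) = e l" unfolding cyl using True by simp
      moreover have "A n \<inter> ?C (Suc m) = {}" by (auto simp: A_def n)
      moreover have "A n \<in> borel_words N" using A_borel by blast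
      ultimately show ?thesis
        using inter[OF _ prefix_cylinder_in_borel_words] empty by metis
    qed
    ultimately have "P (A 0) (e l) = e l"
      using sums_unique2 sums_finite[of "{0}" "\<lambda>n. P (A n) (e l)"] by fastforce
    then show ?thesis using True by (simp add: A_def)
  qed
qed

text \<open>The vectors that are the sum of their components at the atoms form a subspace containing the
  basis. It is closed because every finite partial sum is a coordinate projection, hence a
  contraction, which bounds the partial sums uniformly.\<close>

lemma pvm_atoms_has_sum:
  assumes P: "associated_pvm N S P"
  shows "((\<lambda>\<omega>. P {\<omega>} x) has_sum x) (E ` \<Lambda>)"
proof -
  have words: "\<omega> \<in> topspace (word_space N)" if "\<omega> \<in> E ` \<Lambda>" for \<omega>
    using that encoding_less by (auto simp: topspace_word_space)
  have clin: "bounded_clinear (P {\<omega>})" if "\<omega> \<in> E ` \<Lambda>" for \<omega>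
    using P singleton_in_borel_words[OF words[OF that]]
    by (auto simp: associated_pvm_def projection_valued_measure_def orth_projection_def)
  have contr: "norm (\<Sum>\<omega>\<in>F. P {\<omega>} y) \<le> norm y" if "finite F" "F \<subseteq> E ` \<Lambda>" for F y
  proof (rule norm_coordinate_projection_le[OF basis])
    show "bounded_clinear (\<lambda>y. \<Sum>\<omega>\<in>F. P {\<omega>} y)"
      using that clin by (intro bounded_clinear_sum) auto
    fix l assume "l \<in> \<Lambda>"
    then have "(\<Sum>\<omega>\<in>F. P {\<omega>} (e l)) = (\<Sum>\<omega>\<in>F. if E l = \<omega> then e l else 0)"
      using that words by (intro sum.cong) (auto simp: pvm_singleton_basis[OF P])
    then show "(\<Sum>\<omega>\<in>F. P {\<omega>} (e l)) = e l \<or> (\<Sum>\<omega>\<in>F. P {\<omega>} (e l)) = 0"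
      using that by (simp split: if_splits)
  qed
  let ?V = "{x. ((\<lambda>\<omega>. P {\<omega>} x) has_sum x) (E ` \<Lambda>)}"
  have "x \<in> ?V"
  proof (rule orthonormal_basis_dense[OF basis])
    show "e ` \<Lambda> \<subseteq> ?V"
    proof clarify
      fix l assume l: "l \<in> \<Lambda>"
      have "((\<lambda>\<omega>. if \<omega> = E l then e l else 0) has_sum e l) {E l}"
        using has_sum_finite[of "{E l}" "\<lambda>\<omega>. if \<omega> = E l then e l else 0"] by simp
      then show "((\<lambda>\<omega>. P {\<omega>} (e l)) has_sum e l) (E ` \<Lambda>)"
        by (rule has_sum_cong_neutral[THEN iffD1, rotated -1])
          (use l words in \<open>auto simp: pvm_singleton_basis[OF P]\<close>)
    qed
    show "complex_vector.subspace ?V"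
      unfolding complex_vector.subspace_def
    proof (intro conjI ballI allI; clarsimp)
      show "((\<lambda>\<omega>. P {\<omega>} 0) has_sum 0) (E ` \<Lambda>)"
        by (rule has_sum_0) (use clin bounded_clinear_zero in auto)
      fix y assume y: "((\<lambda>\<omega>. P {\<omega>} y) has_sum y) (E ` \<Lambda>)"
      show "((\<lambda>\<omega>. P {\<omega>} (c *\<^sub>C y)) has_sum c *\<^sub>C y) (E ` \<Lambda>)" for c
        using has_sum_bounded_linear[OF bounded_linear_scaleC y, of c]
        by (rule has_sum_cong[THEN iffD1, rotated])
          (simp add: bounded_clinear_scaleC[OF clin])
      fix z assume "((\<lambda>\<omega>. P {\<omega>} z) has_sum z) (E ` \<Lambda>)"
      from has_sum_add[OF y this]
      show "((\<lambda>\<omega>. P {\<omega>} (y + z)) has_sum (y + z)) (E ` \<Lambda>)"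
        by (rule has_sum_cong[THEN iffD1, rotated]) (simp add: bounded_clinear_add[OF clin])
    qed
    show "closed ?V"
      unfolding closure_subset_eq[symmetric]
    proof (rule subsetI)
      fix z assume "z \<in> closure ?V"
      have "((\<lambda>F. \<Sum>\<omega>\<in>F. P {\<omega>} z) \<longlongrightarrow> z) (finite_subsets_at_top (E ` \<Lambda>))"
      proof (rule tendstoI)
        fix \<epsilon> :: real assume "\<epsilon> > 0"
        then obtain y where y: "y \<in> ?V" "dist y z < \<epsilon> / 3"
          using \<open>z \<in> closure ?V\<close>[unfolded closure_approachable, rule_format, of "\<epsilon> / 3"] by auto
        from y(1) have "((\<lambda>F. \<Sum>\<omega>\<in>F. P {\<omega>} y) \<longlongrightarrow> y) (finite_subsets_at_top (E ` \<Lambda>))"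
          by (simp add: has_sum_def)
        then have "\<forall>\<^sub>F F in finite_subsets_at_top (E ` \<Lambda>). dist (\<Sum>\<omega>\<in>F. P {\<omega>} y) y < \<epsilon> / 3"
          using \<open>\<epsilon> > 0\<close> by (intro tendstoD) auto
        moreover have "\<forall>\<^sub>F F in finite_subsets_at_top (E ` \<Lambda>). finite F \<and> F \<subseteq> E ` \<Lambda>"
          by (rule eventually_finite_subsets_at_top_weakI) blast
        ultimately show "\<forall>\<^sub>F F in finite_subsets_at_top (E ` \<Lambda>). dist (\<Sum>\<omega>\<in>F. P {\<omega>} z) z < \<epsilon>"
        proof eventually_elim
          case (elim F)
          then have F: "finite F" "F \<subseteq> E ` \<Lambda>"
            and near: "dist (\<Sum>\<omega>\<in>F. P {\<omega>} y) y < \<epsilon> / 3" by auto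
          have "(\<Sum>\<omega>\<in>F. P {\<omega>} z) - (\<Sum>\<omega>\<in>F. P {\<omega>} y) = (\<Sum>\<omega>\<in>F. P {\<omega>} (z - y))"
            unfolding sum_subtractf[symmetric] using F(2) bounded_clinear_diff[OF clin]
            by (intro sum.cong) auto
          then have "dist (\<Sum>\<omega>\<in>F. P {\<omega>} z) (\<Sum>\<omega>\<in>F. P {\<omega>} y) \<le> dist y z"
            using contr[of F "z - y"] F by (simp add: dist_norm norm_minus_commute)
          then show "dist (\<Sum>\<omega>\<in>F. P {\<omega>} z) z < \<epsilon>"
            using near y(2) dist_triangle[of "\<Sum>\<omega>\<in>F. P {\<omega>} z" z "\<Sum>\<omega>\<in>F. P {\<omega>} y"]
              dist_triangle[of "\<Sum>\<omega>\<in>F. P {\<omega>} y" z y] by linarith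
        qed
      qed
      then show "z \<in> ?V" by (simp add: has_sum_def)
    qed
  qed
  then show ?thesis by simp
qed

end

theorem theorem4p12:
  fixes N :: nat
    and S :: "nat \<Rightarrow> 'a::chilbert_space \<Rightarrow> 'a"
    and \<Lambda> :: "'l set"
    and e :: "'l \<Rightarrow> 'a"
    and P :: "(nat \<Rightarrow> nat) set \<Rightarrow> 'a \<Rightarrow> 'a"
  assumes "2 \<le> N"
    and "permutative_rep N S \<Lambda> e"
    and "associated_pvm N S P"
  shows "purely_atomic_on N P (encoding N S \<Lambda> e ` \<Lambda>) \<and>
    (\<forall>\<omega> \<in> encoding N S \<Lambda> e ` \<Lambda>.
      orth_projection_onto (P {\<omega>}) (closure (cspan (e ` {l \<in> \<Lambda>. encoding N S \<Lambda> e l = \<omega>}))))"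
proof -
  interpret permutative_representation N S \<Lambda> e
    by unfold_locales (rule assms(2))
  have words: "E ` \<Lambda> \<subseteq> topspace (word_space N)"
    using encoding_less by (auto simp: topspace_word_space)
  have pvm: "projection_valued_measure (topspace (word_space N)) (borel_words N) P"
    using assms(3) by (simp add: associated_pvm_def)
  have "P {\<omega>} \<circ> P {\<omega>'} = (\<lambda>x. 0)" if "\<omega> \<in> E ` \<Lambda>" "\<omega>' \<in> E ` \<Lambda>" "\<omega> \<noteq> \<omega>'" for \<omega> \<omega>'
  proof -
    have "P {\<omega>} \<circ> P {\<omega>'} = P ({\<omega>} \<inter> {\<omega>'})"
      using pvm that words singleton_in_borel_words unfolding projection_valued_measure_def
      by (metis subsetD)
    also have "{\<omega>} \<inter> {\<omega>'} = {}" using that by auto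
    finally show ?thesis using pvm unfolding projection_valued_measure_def by metis
  qed
  then have "purely_atomic_on N P (E ` \<Lambda>)"
    using words pvm_atoms_has_sum[OF assms(3)] by (simp add: purely_atomic_on_def)
  moreover have "orth_projection_onto (P {\<omega>}) (closure (cspan (e ` {l \<in> \<Lambda>. E l = \<omega>})))"
    if "\<omega> \<in> E ` \<Lambda>" for \<omega>
  proof -
    have \<omega>: "\<omega> \<in> topspace (word_space N)" using that words by blast
    have proj: "orth_projection (P {\<omega>})"
      using pvm singleton_in_borel_words[OF \<omega>] by (simp add: projection_valued_measure_def)
    moreover have "range (P {\<omega>}) = closure (cspan (e ` {l \<in> \<Lambda>. E l = \<omega>}))"
      using proj pvm_singleton_basis[OF assms(3) _ \<omega>]
      by (intro range_coordinate_projection[OF basis]) (auto simp: orth_projection_def)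
    ultimately show ?thesis by (simp add: orth_projection_onto_def)
  qed
  ultimately show ?thesis by blast
qed

end
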